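(* Let $\mathcal{G}$ be a finite set of units, $T$ the number of periods and $\bm{d}\in\mathbb{R}^T_+$ a demand vector. For each $g\in\mathcal{G}$ let $\mathcal{X}_g\subseteq\mathbb{R}^T_+\times\{0,1\}^T\times\{0,1\}^{T-1}$ be the set of points $(\bm{p}_g,\bm{x}_g,\bm{u}_g)$ satisfying finitely many linear inequalities, and let $C_g:\mathcal{X}_g\to\mathbb{R}$ be the offer cost function (see context). Assume that $\mathcal{X}_g$ is compact for every $g\in\mathcal{G}$. Define, for $\bm{\pi}\in\mathbb{R}^T$, $$q(\bm{\pi})=\sum_{g\in\mathcal{G}}\Big(\min_{(\bm{p}_g,\bm{x}_g,\bm{u}_g)\in\mathcal{X}_g} C_g(\bm{p}_g,\bm{x}_g,\bm{u}_g)-\bm{\pi}^\top\bm{p}_g\Big)+\bm{\pi}^\top\bm{d},$$ and consider the Lagrangian dual problem $\max_{\bm{\pi}\in\mathbb{R}^T} q(\bm{\pi})$. Then: (a) the optimal objective function value of the Lagrangian dual problem equals the minimum of the problem (called CHP-Primal) $$\min_{\bm{p}_g,\bm{x}_g,\bm{u}_g,\ g\in\mathcal{G}}\ \sum_{g\in\mathcal{G}} C^{**}_{g,\mathcal{X}_g}(\bm{p}_g,\bm{x}_g,\bm{u}_g)\quad\text{s.t.}\quad \sum_{g\in\mathcal{G}}\bm{p}_g=\bm{d},\qquad (\bm{p}_g,\bm{x}_g,\bm{u}_g)\in\mathrm{conv}(\mathcal{X}_g)\ \ \forall g\in\mathcal{G};$$ (b) an optimal dual vector of CHP-Primal associated with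 the constraint $\sum_{g\in\mathcal{G}}\bm{p}_g=\bm{d}$ is an optimal solution of the Lagrangian dual problem $\max_{\bm{\pi}} q(\bm{\pi})$.
   Context: Unit $g$ has dispatch vector $\bm{p}_g\in\mathbb{R}^T_+$, binary commitment vector $\bm{x}_g\in\{0,1\}^T$ and binary start-up vector $\bm{u}_g\in\{0,1\}^{T-1}$ (components indexed by periods $2,\dots,T$). The cost $C_g(\bm{p}_g,\bm{x}_g,\bm{u}_g)$ is convex piecewise linear or convex quadratic in $\bm{p}_g$, with constant start-up and no-load costs. The Lagrangian dual problem is the one obtained from the unit commitment and economic dispatch problem $$\min \sum_{g}C_g(\bm{p}_g,\bm{x}_g,\bm{u}_g)\ \text{ s.t. }\ \sum_g \bm{p}_g=\bm{d},\ (\bm{p}_g,\bm{x}_g,\bm{u}_g)\in\mathcal{X}_g\ \forall g$$ by dualizing the constraint $\sum_g\bm{p}_g=\bm{d}$ (the only, linear, system-wide constraint). $\mathrm{conv}(\cdot)$ denotes the convex hull of a set. $C^{**}_{g,\mathcal{X}_g}$ denotes the convex envelope of $C_g$ taken over $\mathcal{X}_g$: the largest convex function on $\mathrm{conv}(\mathcal{X}_g)$ that is an under-estimator of $C_g$ on $\mathcal{X}_g$. An optimal dual vector of CHP-Primal associated with $\sum_g\bm{p}_g=\bm{d}$ is a vector $\bm{\pi}\in\mathbb{R}^T$ maximizing the dual function obtained by dualizing this constraint in CHP-Primal, i.e. maximizing $\sum_{g}\min_{(\bm{p}_g,\bm{x}_g,\bm{u}_g)\in\mathrm{conv}(\mathcal{X}_g)}\big(C^{**}_{g,\mathcal{X}_g}(\bm{p}_g,\bm{x}_g,\bm{u}_g)-\bm{\pi}^\top\bm{p}_g\big)+\bm{\pi}^\top\bm{d}$.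 "Optimal objective function value" of a maximization problem means its supremum; the value of an infeasible minimization problem is $+\infty$. *)

theory Defs
  imports "HOL-Analysis.Analysis"
begin

text \<open>
  The \<open>T\<close> periods are the elements of a finite linearly ordered type \<open>'t\<close>, so \<open>T = CARD('t)\<close>
  is an arbitrary positive number. A point is a triple \<open>(p, x, u)\<close> of dispatch, commitment and
  start-up vectors. Start-up variables exist only for the periods after the first one: the space
  of start-up vectors of dimension \<open>T - 1\<close>, which is the zero space when \<open>T = 1\<close>, is represented
  by the subspace of vectors over \<open>'t\<close> that vanish in the first period.
\<close>

type_synonym 't schedule = "(real ^ 't) \<times> (real ^ 't) \<times> (real ^ 't)"

definition nonneg_orthant :: "(real ^ 't::finite) set" where
  "nonneg_orthant = {p. \<forall>t. 0 \<le> p $ t}"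

definition schedule_domain :: "'t::{finite,linorder} schedule set" where
  "schedule_domain = {(p, x, u). p \<in> nonneg_orthant \<and> (\<forall>t. x $ t \<in> {0, 1}) \<and>
     (\<forall>t. u $ t \<in> {0, 1}) \<and> u $ Min UNIV = 0}"

definition unit_feasible_set :: "'t::{finite,linorder} schedule set \<Rightarrow> bool" where
  "unit_feasible_set X \<longleftrightarrow> (\<exists>P. polyhedron P \<and> X = schedule_domain \<inter> P)"

definition piecewise_linear_on :: "'a::euclidean_space set \<Rightarrow> ('a \<Rightarrow> real) \<Rightarrow> bool" where
  "piecewise_linear_on S f \<longleftrightarrow> (\<exists>\<F>. finite \<F> \<and> \<Union>\<F> = S \<and>
     (\<forall>P\<in>\<F>. polyhedron P \<and> (\<exists>a b. \<forall>p\<in>P. f p = a \<bullet> p + b)))"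

definition quadratic_on :: "(real ^ 't::finite) set \<Rightarrow> (real ^ 't \<Rightarrow> real) \<Rightarrow> bool" where
  "quadratic_on S f \<longleftrightarrow>
     (\<exists>(Q :: real ^ 't ^ 't) b c. \<forall>p\<in>S. f p = p \<bullet> (Q *v p) + b \<bullet> p + c)"

text \<open>
  No-load and start-up costs are constant in the sense that being on, respectively starting up,
  in a period incurs a fixed charge that does not depend on any decision variable; the charge may
  differ between periods.
\<close>

definition offer_cost ::
  "'t::{finite,linorder} schedule set \<Rightarrow> ('t schedule \<Rightarrow> real) \<Rightarrow> bool" where
  "offer_cost X C \<longleftrightarrow> (\<exists>f noload startup.
     convex_on nonneg_orthant f \<and>
     (piecewise_linear_on nonneg_orthant f \<or> quadratic_on nonneg_orthant f) \<and>
     (\<forall>(p, x, u)\<in>X. C (p, x, u) = f p + noload \<bullet> x + startup \<bullet> u))"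

definition convex_underestimators ::
  "'a::real_vector set \<Rightarrow> ('a \<Rightarrow> real) \<Rightarrow> ('a \<Rightarrow> real) set" where
  "convex_underestimators X C = {h. convex_on (convex hull X) h \<and> (\<forall>z\<in>X. h z \<le> C z)}"

text \<open>
  The supremum below is taken in the reals. If \<open>C\<close> is bounded below on \<open>X\<close>, it is finite on the
  convex hull of \<open>X\<close> and is the largest convex underestimator, see \<open>convex_envelope_greatest\<close>;
  outside the convex hull the value is irrelevant.
\<close>

definition convex_envelope :: "'a::real_vector set \<Rightarrow> ('a \<Rightarrow> real) \<Rightarrow> 'a \<Rightarrow> real" where
  "convex_envelope X C z = (SUP h\<in>convex_underestimators X C. h z)"

lemma convex_underestimators_bdd_above:
  assumes "z \<in> convex hull X"
  shows "bdd_above ((\<lambda>h. h z) ` convex_underestimators X C)"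
proof -
  obtain S c where S: "finite S" "S \<subseteq> X" "\<forall>x\<in>S. 0 \<le> c x" "sum c S = 1"
    and z: "(\<Sum>v\<in>S. c v *\<^sub>R v) = z"
    using assms unfolding convex_hull_explicit by blast
  have "S \<noteq> {}" using S(4) by auto
  have "h z \<le> (\<Sum>v\<in>S. c v * C v)" if h: "h \<in> convex_underestimators X C" for h
  proof -
    have cvx: "convex_on (convex hull X) h" and le: "\<And>v. v \<in> X \<Longrightarrow> h v \<le> C v"
      using h by (auto simp: convex_underestimators_def)
    have "h (\<Sum>v\<in>S. c v *\<^sub>R v) \<le> (\<Sum>v\<in>S. c v * h v)"
      using S \<open>S \<noteq> {}\<close> hull_subset[of X convex]
      by (intro convex_on_sum[OF _ _ cvx]) auto
    also have "\<dots> \<le> (\<Sum>v\<in>S. c v * C v)"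
      using S le by (intro sum_mono mult_left_mono) auto
    finally show ?thesis using z by simp
  qed
  then show ?thesis by (intro bdd_aboveI2)
qed

lemma convex_envelope_greatest:
  assumes "bdd_below (C ` X)"
  shows "convex_envelope X C \<in> convex_underestimators X C"
    and "\<And>h z. h \<in> convex_underestimators X C \<Longrightarrow> z \<in> convex hull X \<Longrightarrow> h z \<le> convex_envelope X C z"
proof -
  let ?H = "convex_underestimators X C" and ?K = "convex hull X"
  obtain m where m: "\<And>z. z \<in> X \<Longrightarrow> m \<le> C z"
    using assms by (auto simp: bdd_below_def)
  have "(\<lambda>_. m) \<in> ?H"
    using m by (simp add: convex_underestimators_def convex_on_const)
  then have ne: "?H \<noteq> {}" by auto
  show upper: "h z \<le> convex_envelope X C z" if "h \<in> ?H" "z \<in> ?K" for h z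
    unfolding convex_envelope_def
    using that by (intro cSUP_upper convex_underestimators_bdd_above)
  have "convex_on ?K (convex_envelope X C)"
  proof (rule convex_onI)
    fix t :: real and y z assume t: "0 < t" "t < 1" and yz: "y \<in> ?K" "z \<in> ?K"
    show "convex_envelope X C ((1 - t) *\<^sub>R y + t *\<^sub>R z)
        \<le> (1 - t) * convex_envelope X C y + t * convex_envelope X C z"
      unfolding convex_envelope_def[of X C "(1 - t) *\<^sub>R y + t *\<^sub>R z"]
    proof (rule cSUP_least[OF ne])
      fix h assume h: "h \<in> ?H"
      then have "h ((1 - t) *\<^sub>R y + t *\<^sub>R z) \<le> (1 - t) * h y + t * h z"
        using t yz by (intro convex_onD[of ?K]) (auto simp: convex_underestimators_def)
      also have "\<dots> \<le> (1 - t) * convex_envelope X C y + t * convex_envelope X C z"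
        using t upper[OF h] yz by (intro add_mono mult_left_mono) auto
      finally show "h ((1 - t) *\<^sub>R y + t *\<^sub>R z)
        \<le> (1 - t) * convex_envelope X C y + t * convex_envelope X C z" .
    qed
  qed (rule convex_convex_hull)
  moreover have "convex_envelope X C z \<le> C z" if "z \<in> X" for z
    unfolding convex_envelope_def
    using that by (intro cSUP_least[OF ne]) (auto simp: convex_underestimators_def)
  ultimately show "convex_envelope X C \<in> ?H"
    by (simp add: convex_underestimators_def)
qed

text \<open>
  The dual function obtained from minimizing \<open>\<Sum>g\<in>G. c g (z g)\<close> over \<open>z g \<in> S g\<close> by dualizing the
  balance constraint \<open>(\<Sum>g\<in>G. fst (z g)) = d\<close>. It is extended-real valued because the inner
  problem of a unit with \<open>S g = {}\<close> has value \<open>\<infinity>\<close>.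
\<close>

definition dual_function ::
  "'g set \<Rightarrow> ('g \<Rightarrow> 't::finite schedule set) \<Rightarrow> ('g \<Rightarrow> 't schedule \<Rightarrow> real) \<Rightarrow> real ^ 't
     \<Rightarrow> real ^ 't \<Rightarrow> ereal" where
  "dual_function G S c d \<pi> =
     (\<Sum>g\<in>G. INF z\<in>S g. ereal (c g z - \<pi> \<bullet> fst z)) + ereal (\<pi> \<bullet> d)"

definition chp_feasible ::
  "'g set \<Rightarrow> ('g \<Rightarrow> 't::finite schedule set) \<Rightarrow> real ^ 't \<Rightarrow> ('g \<Rightarrow> 't schedule) set" where
  "chp_feasible G X d =
     {z. (\<Sum>g\<in>G. fst (z g)) = d \<and> (\<forall>g\<in>G. z g \<in> convex hull (X g))}"

definition chp_objective ::
  "'g set \<Rightarrow> ('g \<Rightarrow> 't::finite schedule set) \<Rightarrow> ('g \<Rightarrow> 't schedule \<Rightarrow> real)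
     \<Rightarrow> ('g \<Rightarrow> 't schedule) \<Rightarrow> real" where
  "chp_objective G X C z = (\<Sum>g\<in>G. convex_envelope (X g) (C g) (z g))"

definition chp_dual_function ::
  "'g set \<Rightarrow> ('g \<Rightarrow> 't::finite schedule set) \<Rightarrow> ('g \<Rightarrow> 't schedule \<Rightarrow> real) \<Rightarrow> real ^ 't
     \<Rightarrow> real ^ 't \<Rightarrow> ereal" where
  "chp_dual_function G X C d =
     dual_function G (\<lambda>g. convex hull (X g)) (\<lambda>g. convex_envelope (X g) (C g)) d"

end

theory Submission
  imports Defs
begin

text \<open>
  The convex hull of the graph of \<open>C g\<close> is compact, and its lower boundary is the convex envelope
  of \<open>C g\<close>. Hence the set \<open>M\<close> of all pairs of total dispatch and total cost that arise from these
  hulls is compact and convex, and the value of CHP-Primal is the lowest point of \<open>M\<close> on the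
  vertical line above \<open>d\<close>. Any pair \<open>(d, r)\<close> below that point is strictly separated from \<open>M\<close>; a
  separating hyperplane can be chosen non-vertical, and its slope is a price vector at which the
  dual function exceeds \<open>r\<close>. Moreover, passing from a cost on a set to its convex envelope on the
  convex hull does not change the minimum after subtracting a linear function, so both dual
  functions coincide.
\<close>

subsection \<open>Convex envelopes\<close>

text \<open>Taking the hull of the graph instead of the epigraph keeps the set compact for compact
  \<open>X\<close> and continuous \<open>C\<close>.\<close>

definition graph_hull :: "'a::real_vector set \<Rightarrow> ('a \<Rightarrow> real) \<Rightarrow> ('a \<times> real) set" where
  "graph_hull X C = convex hull ((\<lambda>z. (z, C z)) ` X)"

lemma convex_graph_hull: "convex (graph_hull X C)"
  by (simp add: graph_hull_def convex_convex_hull)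

lemma graph_in_graph_hull: "z \<in> X \<Longrightarrow> (z, C z) \<in> graph_hull X C"
  unfolding graph_hull_def by (intro hull_inc) auto

lemma fst_graph_hull: "fst ` graph_hull X C = convex hull X"
  by (simp add: graph_hull_def convex_hull_linear_image linear_fst image_image)

lemma compact_graph_hull:
  fixes X :: "'a::euclidean_space set"
  assumes "compact X" "continuous_on X C"
  shows "compact (graph_hull X C)"
  unfolding graph_hull_def
  using assms by (intro compact_convex_hull compact_continuous_image continuous_intros)

lemma bdd_below_continuous_image_compact:
  fixes C :: "'a::topological_space \<Rightarrow> real"
  assumes "compact X" "continuous_on X C"
  shows "bdd_below (C ` X)"
  using assms by (intro bounded_imp_bdd_below compact_imp_bounded compact_continuous_image)

text \<open>The epigraph of the envelope is convex and contains the graph of \<open>C\<close>, hence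
  also its hull.\<close>

lemma convex_envelope_le_graph_hull:
  assumes "bdd_below (C ` X)" "(z, s) \<in> graph_hull X C"
  shows "convex_envelope X C z \<le> s"
proof -
  have env: "convex_on (convex hull X) (convex_envelope X C)"
    "\<And>z. z \<in> X \<Longrightarrow> convex_envelope X C z \<le> C z"
    using convex_envelope_greatest(1)[OF assms(1)] by (auto simp: convex_underestimators_def)
  have "graph_hull X C \<subseteq> epigraph (convex hull X) (convex_envelope X C)"
    unfolding graph_hull_def
    using env by (intro hull_minimal convex_epigraphI) (auto simp: mem_epigraph hull_inc)
  then show ?thesis
    using assms(2) by (auto simp: mem_epigraph)
qed

text \<open>The lowest points of the vertical fibres define a convex underestimator
  \<open>E\<close>. Maximality of the envelope bounds \<open>E\<close> from above, and the preceding
  lemma gives the other inequality.\<close>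

lemma convex_envelope_in_graph_hull:
  fixes X :: "'a::euclidean_space set"
  assumes "compact X" "continuous_on X C" and z: "z \<in> convex hull X"
  shows "(z, convex_envelope X C z) \<in> graph_hull X C"
proof -
  have bdd: "bdd_below (C ` X)"
    using assms by (intro bdd_below_continuous_image_compact)
  have "\<exists>s. (y, s) \<in> graph_hull X C \<and> (\<forall>s'. (y, s') \<in> graph_hull X C \<longrightarrow> s \<le> s')"
    if y: "y \<in> convex hull X" for y
  proof -
    \<comment> \<open>The fibre over \<open>y\<close> is nonempty because the graph hull projects
      onto the convex hull of \<open>X\<close>.\<close>
    let ?F = "graph_hull X C \<inter> {y} \<times> UNIV"
    have "compact ?F"
      using assms by (intro compact_Int_closed compact_graph_hull closed_Times) auto
    moreover have "?F \<noteq> {}"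
      using y unfolding fst_graph_hull[symmetric, of X C] by force
    ultimately obtain w where "w \<in> ?F" "\<forall>w'\<in>?F. snd w \<le> snd w'"
      using continuous_attains_inf[OF _ _ continuous_on_snd[OF continuous_on_id]] by blast
    then show ?thesis by (intro exI[of _ "snd w"]) force
  qed
  then obtain E where E: "\<And>y. y \<in> convex hull X \<Longrightarrow> (y, E y) \<in> graph_hull X C"
    and E_le: "\<And>y s. y \<in> convex hull X \<Longrightarrow> (y, s) \<in> graph_hull X C \<Longrightarrow> E y \<le> s"
    by metis
  have "convex_on (convex hull X) E"
  proof (rule convex_onI)
    fix t :: real and x y assume t: "0 < t" "t < 1" and xy: "x \<in> convex hull X" "y \<in> convex hull X"
    \<comment> \<open>The chord between two lowest points stays in the graph hull, so its height is
      at least that of the lowest point in its fibre.\<close>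
    have "(1 - t) *\<^sub>R (x, E x) + t *\<^sub>R (y, E y) \<in> graph_hull X C"
      using t E[OF xy(1)] E[OF xy(2)] by (intro convexD[OF convex_graph_hull]) auto
    moreover have "(1 - t) *\<^sub>R x + t *\<^sub>R y \<in> convex hull X"
      using t xy by (intro convexD[OF convex_convex_hull]) auto
    ultimately show "E ((1 - t) *\<^sub>R x + t *\<^sub>R y) \<le> (1 - t) * E x + t * E y"
      by (intro E_le) auto
  qed (rule convex_convex_hull)
  then have "E \<in> convex_underestimators X C"
    by (auto simp: convex_underestimators_def hull_inc intro: E_le graph_in_graph_hull)
  then have "E z \<le> convex_envelope X C z"
    using z by (rule convex_envelope_greatest(2)[OF bdd])
  moreover have "convex_envelope X C z \<le> E z"
    using bdd E[OF z] by (rule convex_envelope_le_graph_hull)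
  ultimately show ?thesis
    using E[OF z] by simp
qed

text \<open>If \<open>m\<close> is a lower bound of \<open>C - l\<close> on \<open>X\<close>, then
  \<open>m + l\<close> is an affine underestimator of \<open>C\<close> and so lies below the
  envelope. Arguing with real lower bounds also covers empty \<open>X\<close>, where both infima are
  \<infinity>.\<close>

lemma INF_convex_envelope_minus_linear:
  fixes l :: "'a::real_vector \<Rightarrow> real"
  assumes bdd: "bdd_below (C ` X)" and l: "linear l"
  shows "(INF z\<in>convex hull X. ereal (convex_envelope X C z - l z)) = (INF z\<in>X. ereal (C z - l z))"
proof (rule antisym)
  have "convex_envelope X C z \<le> C z" if "z \<in> X" for z
    using convex_envelope_greatest(1)[OF bdd] that by (auto simp: convex_underestimators_def)
  then show "(INF z\<in>convex hull X. ereal (convex_envelope X C z - l z))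
      \<le> (INF z\<in>X. ereal (C z - l z))"
    by (intro INF_mono) (auto intro!: bexI hull_inc)
  have "ereal m \<le> (INF z\<in>convex hull X. ereal (convex_envelope X C z - l z))"
    if m: "ereal m \<le> (INF z\<in>X. ereal (C z - l z))" for m
  proof -
    have "m + l z \<le> C z" if "z \<in> X" for z
      using INF_lower2[OF that order_refl, of "\<lambda>z. ereal (C z - l z)"] order_trans[OF m] by force
    moreover have "convex_on (convex hull X) (\<lambda>z. m + l z)"
    proof (rule convex_onI)
      fix t :: real and x y
      show "m + l ((1 - t) *\<^sub>R x + t *\<^sub>R y) \<le> (1 - t) * (m + l x) + t * (m + l y)"
        using l by (simp add: linear_add linear_cmul distrib_left left_diff_distrib)
    qed (rule convex_convex_hull)
    ultimately have "(\<lambda>z. m + l z) \<in> convex_underestimators X C"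
      by (simp add: convex_underestimators_def)
    from convex_envelope_greatest(2)[OF bdd this]
    show ?thesis by (intro INF_greatest) (simp add: algebra_simps)
  qed
  then show "(INF z\<in>X. ereal (C z - l z))
      \<le> (INF z\<in>convex hull X. ereal (convex_envelope X C z - l z))"
    using ereal_dense2 by (meson leD less_imp_le not_le)
qed

subsection \<open>Non-vertical separation\<close>

lemma compact_set_sum:
  fixes B :: "'i \<Rightarrow> 'a::real_normed_vector set"
  assumes "\<And>i. i \<in> A \<Longrightarrow> compact (B i)"
  shows "compact (\<Sum>i\<in>A. B i)"
  using assms
proof (induction A rule: infinite_finite_induct)
  case (insert i A)
  then have "compact {x + y |x y. x \<in> B i \<and> y \<in> (\<Sum>i\<in>A. B i)}"
    by (intro compact_sums) auto
  also have "{x + y |x y. x \<in> B i \<and> y \<in> (\<Sum>i\<in>A. B i)} = B i + (\<Sum>i\<in>A. B i)"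
    by (auto simp: set_plus_def)
  finally show ?case using insert.hyps by simp
qed (auto simp: set_zero)

lemma nonvertical_separation:
  fixes M :: "('a::euclidean_space \<times> real) set"
  assumes M: "compact M" "convex M"
    and below: "\<And>s. (d, s) \<in> M \<Longrightarrow> r < s"
  shows "\<exists>\<pi>. \<forall>(p, s)\<in>M. r < s + \<pi> \<bullet> (d - p)"
proof (cases "d \<in> fst ` M")
  case True
  then obtain v where v: "(d, v) \<in> M" by force
  have "(d, r) \<notin> M" using below by blast
  then obtain w \<beta> where w: "w \<bullet> (d, r) < \<beta>" "\<And>x. x \<in> M \<Longrightarrow> w \<bullet> x > \<beta>"
    using separating_hyperplane_closed_point[of M "(d, r)"] M compact_imp_closed by metis
  obtain a b where ab: "w = (a, b)" by (cases w)
  have sep: "a \<bullet> d + b * r < a \<bullet> p + b * s" if "(p, s) \<in> M" for p s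
    using w(1) w(2)[OF that] by (simp add: ab inner_prod_def)
  \<comment> \<open>Both points lie above \<open>d\<close>, so the \<open>a\<close> terms cancel.
    This forces \<open>b\<close> to be positive: the hyperplane is not vertical.\<close>
  have "0 < b * (v - r)" using sep[OF v] by (simp add: algebra_simps)
  with below[OF v] have b: "0 < b" by (simp add: zero_less_mult_iff)
  have "r < s + (- (1 / b) *\<^sub>R a) \<bullet> (d - p)" if "(p, s) \<in> M" for p s
    using sep[OF that] b by (simp add: inner_diff_right field_simps)
  then show ?thesis by (intro exI[of _ "- (1 / b) *\<^sub>R a"]) auto
next
  case False
  \<comment> \<open>No point of \<open>M\<close> lies above \<open>d\<close>, so \<open>d\<close> is
    separated from the projection of \<open>M\<close>. That hyperplane is vertical in the product
    space; a steep multiple of its normal serves as slope.\<close>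
  have "compact (fst ` M)" "convex (fst ` M)"
    using M by (auto intro!: compact_continuous_image convex_linear_image linear_fst
        continuous_on_fst continuous_on_id)
  then obtain a \<beta> where a: "a \<bullet> d < \<beta>" "\<And>x. x \<in> fst ` M \<Longrightarrow> a \<bullet> x > \<beta>"
    using separating_hyperplane_closed_point[of "fst ` M" d] False compact_imp_closed by metis
  obtain m where m: "\<And>x. x \<in> M \<Longrightarrow> m \<le> snd x"
    using bdd_below_continuous_image_compact[OF M(1) continuous_on_snd[OF continuous_on_id]]
    unfolding bdd_below_def by blast
  \<comment> \<open>The factor \<open>t\<close> makes the gap \<open>\<beta> - a \<bullet> d\<close>
    outweigh \<open>r - m\<close>, with \<open>m\<close> a lower bound of the heights in
    \<open>M\<close>. Adding 1 to \<open>t\<close> later makes the inequality strict.\<close>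
  define t where "t = \<bar>r - m\<bar> / (\<beta> - a \<bullet> d)"
  have t: "0 \<le> t" "r - m \<le> t * (\<beta> - a \<bullet> d)"
    using a(1) by (auto simp: t_def)
  have "r < s + (- (t + 1) *\<^sub>R a) \<bullet> (d - p)" if "(p, s) \<in> M" for p s
  proof -
    have p: "\<beta> < a \<bullet> p" using a(2) that by force
    have "r \<le> m + t * (\<beta> - a \<bullet> d)" using t by simp
    also have "\<dots> < m + (t + 1) * (\<beta> - a \<bullet> d)" using a(1) by (simp add: algebra_simps)
    also have "\<dots> \<le> s + (t + 1) * (a \<bullet> p - a \<bullet> d)"
      using m[OF that] p t(1) by (intro add_mono mult_left_mono) auto
    finally show ?thesis by (simp add: inner_diff_right algebra_simps)
  qed
  then show ?thesis by (intro exI[of _ "- (t + 1) *\<^sub>R a"]) auto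
qed

subsection \<open>Continuity of offer costs\<close>

text \<open>Affine functions on finitely many closed pieces paste together continuously.\<close>

lemma piecewise_linear_on_continuous:
  assumes "piecewise_linear_on S f"
  shows "continuous_on S f"
proof -
  obtain \<F> where \<F>: "finite \<F>" "\<Union>\<F> = S"
    and pieces: "\<And>P. P \<in> \<F> \<Longrightarrow> polyhedron P \<and> (\<exists>a b. \<forall>p\<in>P. f p = a \<bullet> p + b)"
    using assms unfolding piecewise_linear_on_def by blast
  have "continuous_on P f" if P: "P \<in> \<F>" for P
  proof -
    obtain a b where "\<forall>p\<in>P. f p = a \<bullet> p + b" using pieces[OF P] by blast
    moreover have "continuous_on P (\<lambda>p. a \<bullet> p + b)" by (intro continuous_intros)
    ultimately show ?thesis by (simp cong: continuous_on_cong)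
  qed
  then have "continuous_on (\<Union>P\<in>\<F>. P) f"
    using \<F>(1) pieces by (intro continuous_on_closed_Union) (auto intro: polyhedron_imp_closed)
  then show ?thesis using \<F>(2) by simp
qed

lemma quadratic_on_continuous:
  assumes "quadratic_on S f"
  shows "continuous_on S f"
proof -
  obtain Q b c where "\<forall>p\<in>S. f p = p \<bullet> (Q *v p) + b \<bullet> p + c"
    using assms unfolding quadratic_on_def by blast
  moreover have "continuous_on S (\<lambda>p. p \<bullet> (Q *v p) + b \<bullet> p + c)"
    by (intro continuous_intros linear_continuous_on_compose matrix_vector_mul_linear)
  ultimately show ?thesis by (simp cong: continuous_on_cong)
qed

text \<open>Continuity is drawn from the piecewise linear or quadratic form, since a convex function
  may jump at the boundary of the orthant.\<close>

lemma offer_cost_continuous: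
  assumes "offer_cost X C" "X \<subseteq> schedule_domain"
  shows "continuous_on X C"
proof -
  obtain f noload startup where f: "continuous_on nonneg_orthant f"
    and C: "\<forall>(p, x, u)\<in>X. C (p, x, u) = f p + noload \<bullet> x + startup \<bullet> u"
    using assms(1) piecewise_linear_on_continuous quadratic_on_continuous
    unfolding offer_cost_def by blast
  have "continuous_on X (\<lambda>z. f (fst z) + noload \<bullet> fst (snd z) + startup \<bullet> snd (snd z))"
    using assms(2)
    by (intro continuous_intros continuous_on_compose2[OF f]) (auto simp: schedule_domain_def)
  then show ?thesis
    by (rule continuous_on_eq) (use C in auto)
qed

subsection \<open>Duality\<close>

lemma dual_function_eq_infinity:
  assumes "finite G" "g \<in> G" "S g = {}"
  shows "dual_function G S c d \<pi> = \<infinity>"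
proof -
  \<comment> \<open>The infimum over the empty set is \<infinity>, which absorbs every other summand
    in \<open>ereal\<close>, even -\<infinity>.\<close>
  have "(\<Sum>g\<in>G. INF z\<in>S g. ereal (c g z - \<pi> \<bullet> fst z)) = \<infinity>"
    unfolding sum_Pinfty using assms by (auto intro!: bexI[of _ g] simp: top_ereal_def)
  then show ?thesis by (simp add: dual_function_def)
qed

text \<open>Dualizing the balance constraint decouples the units, so minimizers chosen unit by unit
  attain the whole sum.\<close>

lemma dual_function_attained:
  assumes "\<And>g. g \<in> G \<Longrightarrow> compact (S g)" "\<And>g. g \<in> G \<Longrightarrow> continuous_on (S g) (c g)"
    and "\<And>g. g \<in> G \<Longrightarrow> S g \<noteq> {}"
  obtains z where "\<And>g. g \<in> G \<Longrightarrow> z g \<in> S g"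
    and "dual_function G S c d \<pi> = ereal ((\<Sum>g\<in>G. c g (z g)) + \<pi> \<bullet> (d - (\<Sum>g\<in>G. fst (z g))))"
proof -
  have "\<exists>z\<in>S g. \<forall>y\<in>S g. c g z - \<pi> \<bullet> fst z \<le> c g y - \<pi> \<bullet> fst y" if "g \<in> G" for g
    using that assms by (intro continuous_attains_inf continuous_intros) auto
  then obtain z where z: "\<And>g. g \<in> G \<Longrightarrow> z g \<in> S g"
    and min: "\<And>g y. g \<in> G \<Longrightarrow> y \<in> S g \<Longrightarrow> c g (z g) - \<pi> \<bullet> fst (z g) \<le> c g y - \<pi> \<bullet> fst y"
    by metis
  have "(INF y\<in>S g. ereal (c g y - \<pi> \<bullet> fst y)) = ereal (c g (z g) - \<pi> \<bullet> fst (z g))"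
    if "g \<in> G" for g
    using z[OF that] min[OF that] by (intro antisym INF_greatest INF_lower) auto
  then have "dual_function G S c d \<pi> = ereal ((\<Sum>g\<in>G. c g (z g) - \<pi> \<bullet> fst (z g)) + \<pi> \<bullet> d)"
    by (simp add: dual_function_def)
  then show ?thesis
    using z by (intro that) (auto simp: sum_subtractf inner_diff_right inner_sum_right)
qed

lemma chp_dual_function_eq_dual_function:
  fixes X :: "'g \<Rightarrow> 'b::finite schedule set"
  assumes "\<And>g. g \<in> G \<Longrightarrow> bdd_below (C g ` X g)"
  shows "chp_dual_function G X C d = dual_function G X C d"
proof (rule ext)
  fix \<pi> :: "real ^ 'b"
  have "linear (\<lambda>z. \<pi> \<bullet> fst z)"
    by (intro linearI) (simp_all add: inner_add_right)
  with assms show "chp_dual_function G X C d \<pi> = dual_function G X C d \<pi>"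
    unfolding chp_dual_function_def dual_function_def
    by (intro arg_cong2[where f = "(+)"] sum.cong INF_convex_envelope_minus_linear) auto
qed

text \<open>A feasible \<open>z\<close> competes in every inner infimum, and its price terms cancel
  because its dispatches sum to \<open>d\<close>.\<close>

lemma chp_weak_duality:
  assumes "z \<in> chp_feasible G X d"
  shows "chp_dual_function G X C d \<pi> \<le> ereal (chp_objective G X C z)"
proof -
  have "chp_dual_function G X C d \<pi>
      \<le> (\<Sum>g\<in>G. ereal (convex_envelope (X g) (C g) (z g) - \<pi> \<bullet> fst (z g))) + ereal (\<pi> \<bullet> d)"
    using assms unfolding chp_dual_function_def dual_function_def
    by (intro add_mono sum_mono INF_lower) (auto simp: chp_feasible_def)
  also have "\<dots> = ereal (chp_objective G X C z)"
    using assms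
    by (auto simp: chp_objective_def chp_feasible_def sum_subtractf inner_sum_right)
  finally show ?thesis .
qed

text \<open>This is the set \<open>M\<close> of the opening comment. As a Minkowski sum of linear
  images of graph hulls it inherits convexity and compactness from them.\<close>

definition total_dispatch_cost ::
  "'g set \<Rightarrow> ('g \<Rightarrow> 't::finite schedule set) \<Rightarrow> ('g \<Rightarrow> 't schedule \<Rightarrow> real)
     \<Rightarrow> ((real ^ 't) \<times> real) set" where
  "total_dispatch_cost G X C = (\<Sum>g\<in>G. (\<lambda>w. (fst (fst w), snd w)) ` graph_hull (X g) (C g))"

lemma convex_total_dispatch_cost: "convex (total_dispatch_cost G X C)"
proof -
  have "linear (\<lambda>w :: ('a schedule \<times> real). (fst (fst w), snd w))"
    by (intro linearI) auto
  then show ?thesis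
    unfolding total_dispatch_cost_def
    by (intro convex_set_sum convex_linear_image convex_graph_hull)
qed

lemma compact_total_dispatch_cost:
  assumes "\<And>g. g \<in> G \<Longrightarrow> compact (X g)" "\<And>g. g \<in> G \<Longrightarrow> continuous_on (X g) (C g)"
  shows "compact (total_dispatch_cost G X C)"
  unfolding total_dispatch_cost_def using assms
  by (intro compact_set_sum compact_continuous_image compact_graph_hull continuous_intros)

lemma total_dispatch_costI:
  assumes "finite G" "\<And>g. g \<in> G \<Longrightarrow> (z g, s g) \<in> graph_hull (X g) (C g)"
  shows "((\<Sum>g\<in>G. fst (z g)), (\<Sum>g\<in>G. s g)) \<in> total_dispatch_cost G X C"
  unfolding total_dispatch_cost_def set_sum_alt[OF assms(1)]
  using assms(2)
  by (auto intro!: exI[of _ "\<lambda>g. (fst (z g), s g)"] rev_image_eqI simp: sum_prod)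

lemma total_dispatch_costE:
  assumes "finite G" "(p, r) \<in> total_dispatch_cost G X C"
  obtains z s where "\<And>g. g \<in> G \<Longrightarrow> (z g, s g) \<in> graph_hull (X g) (C g)"
    "p = (\<Sum>g\<in>G. fst (z g))" "r = (\<Sum>g\<in>G. s g)"
proof -
  obtain q where q: "(p, r) = (\<Sum>g\<in>G. q g)"
    and "\<And>g. g \<in> G \<Longrightarrow> q g \<in> (\<lambda>w. (fst (fst w), snd w)) ` graph_hull (X g) (C g)"
    using assms(2) unfolding total_dispatch_cost_def set_sum_alt[OF assms(1)] by auto
  then have "\<exists>w. w \<in> graph_hull (X g) (C g) \<and> q g = (fst (fst w), snd w)" if "g \<in> G" for g
    using that by blast
  then obtain w where w: "\<And>g. g \<in> G \<Longrightarrow> w g \<in> graph_hull (X g) (C g)"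
    "\<And>g. g \<in> G \<Longrightarrow> q g = (fst (fst (w g)), snd (w g))"
    by metis
  show ?thesis
  proof (rule that[of "\<lambda>g. fst (w g)" "\<lambda>g. snd (w g)"])
    have "(p, r) = (\<Sum>g\<in>G. (fst (fst (w g)), snd (w g)))"
      using q w(2) by simp
    then show "p = (\<Sum>g\<in>G. fst (fst (w g)))" "r = (\<Sum>g\<in>G. snd (w g))"
      by (simp_all add: sum_prod)
  qed (use w(1) in auto)
qed

text \<open>Together with the next lemma this identifies the lowest point of the fibre over
  \<open>d\<close> with the optimum of CHP-Primal. Only an inequality holds here, since a point of a
  graph hull may lie above the envelope.\<close>

lemma chp_objective_le_total_cost:
  assumes "finite G" "\<And>g. g \<in> G \<Longrightarrow> bdd_below (C g ` X g)"
    and "(d, s) \<in> total_dispatch_cost G X C"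
  shows "\<exists>z\<in>chp_feasible G X d. chp_objective G X C z \<le> s"
proof -
  obtain z s' where *: "\<And>g. g \<in> G \<Longrightarrow> (z g, s' g) \<in> graph_hull (X g) (C g)"
    "d = (\<Sum>g\<in>G. fst (z g))" "s = (\<Sum>g\<in>G. s' g)"
    using total_dispatch_costE[OF assms(1,3)] by metis
  have "z g \<in> convex hull (X g)" if "g \<in> G" for g
    using *(1)[OF that] unfolding fst_graph_hull[symmetric, of "X g" "C g"] by force
  then show ?thesis
    using * assms(2)
    by (intro bexI[of _ z])
      (auto simp: chp_feasible_def chp_objective_def intro!: sum_mono convex_envelope_le_graph_hull)
qed

lemma chp_objective_in_total_cost:
  assumes "finite G" "\<And>g. g \<in> G \<Longrightarrow> compact (X g)" "\<And>g. g \<in> G \<Longrightarrow> continuous_on (X g) (C g)"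
    and z: "z \<in> chp_feasible G X d"
  shows "(d, chp_objective G X C z) \<in> total_dispatch_cost G X C"
proof -
  have "((\<Sum>g\<in>G. fst (z g)), (\<Sum>g\<in>G. convex_envelope (X g) (C g) (z g)))
      \<in> total_dispatch_cost G X C"
    using assms
    by (intro total_dispatch_costI convex_envelope_in_graph_hull) (auto simp: chp_feasible_def)
  then show ?thesis
    using z by (simp add: chp_objective_def chp_feasible_def)
qed

section \<open>Attainment and strong duality\<close>

text \<open>Minimizing height over the compact fibre of \<open>total_dispatch_cost\<close> above
  \<open>d\<close> replaces a semicontinuity argument for the envelopes.\<close>

lemma chp_primal_attained:
  assumes "finite G" "\<And>g. g \<in> G \<Longrightarrow> compact (X g)" "\<And>g. g \<in> G \<Longrightarrow> continuous_on (X g) (C g)"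
    and feas: "chp_feasible G X d \<noteq> {}"
  shows "\<exists>z\<in>chp_feasible G X d. \<forall>z'\<in>chp_feasible G X d. chp_objective G X C z \<le> chp_objective G X C z'"
proof -
  let ?F = "total_dispatch_cost G X C \<inter> {d} \<times> UNIV"
  have in_total: "(d, chp_objective G X C z) \<in> total_dispatch_cost G X C"
    if "z \<in> chp_feasible G X d" for z
    using assms(1-3) that by (rule chp_objective_in_total_cost)
  have bdd: "bdd_below (C g ` X g)" if "g \<in> G" for g
    using assms(2,3) that by (intro bdd_below_continuous_image_compact)
  have "compact ?F"
    using assms by (intro compact_Int_closed compact_total_dispatch_cost closed_Times) auto
  moreover have "?F \<noteq> {}"
    using feas in_total by blast
  ultimately obtain w where w: "w \<in> ?F" "\<forall>w'\<in>?F. snd w \<le> snd w'"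
    using continuous_attains_inf[OF _ _ continuous_on_snd[OF continuous_on_id]] by blast
  have "\<exists>z\<in>chp_feasible G X d. chp_objective G X C z \<le> snd w"
    using w(1) by (intro chp_objective_le_total_cost[OF assms(1) bdd]) auto
  then obtain z where z: "z \<in> chp_feasible G X d" "chp_objective G X C z \<le> snd w"
    by blast
  have "snd w \<le> chp_objective G X C z'" if "z' \<in> chp_feasible G X d" for z'
    using w(2) in_total[OF that] by force
  then show ?thesis using z by force
qed

lemma chp_strong_duality:
  assumes "finite G" "\<And>g. g \<in> G \<Longrightarrow> compact (X g)" "\<And>g. g \<in> G \<Longrightarrow> continuous_on (X g) (C g)"
  shows "(INF z\<in>chp_feasible G X d. ereal (chp_objective G X C z)) \<le> (SUP \<pi>. dual_function G X C d \<pi>)"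
proof (rule ccontr)
  assume "\<not> ?thesis"
  then have "(SUP \<pi>. dual_function G X C d \<pi>)
      < (INF z\<in>chp_feasible G X d. ereal (chp_objective G X C z))"
    by (simp only: not_le)
  from ereal_dense2[OF this] obtain r where r: "ereal r < (INF z\<in>chp_feasible G X d. ereal (chp_objective G X C z))"
    "(SUP \<pi>. dual_function G X C d \<pi>) < ereal r"
    by blast
  have small: "dual_function G X C d \<pi> < ereal r" for \<pi>
    using r(2) SUP_upper[of \<pi> UNIV "dual_function G X C d"] by (simp add: le_less_trans)
  \<comment> \<open>An empty unit would make the dual function \<infinity> at price 0.\<close>
  have ne: "X g \<noteq> {}" if "g \<in> G" for g
    using small[of 0] dual_function_eq_infinity[of G g X C d 0] assms(1) that by auto
  have bdd: "bdd_below (C g ` X g)" if "g \<in> G" for g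
    using assms(2,3) that by (intro bdd_below_continuous_image_compact)
  \<comment> \<open>If CHP-Primal is infeasible, no such \<open>s\<close> exists; separation then
    still applies, through its case where nothing lies above \<open>d\<close>.\<close>
  have "r < s" if "(d, s) \<in> total_dispatch_cost G X C" for s
  proof -
    have "\<exists>z\<in>chp_feasible G X d. chp_objective G X C z \<le> s"
      using assms(1) bdd that by (rule chp_objective_le_total_cost)
    then obtain z where z: "z \<in> chp_feasible G X d" "chp_objective G X C z \<le> s"
      by blast
    have "ereal r < ereal (chp_objective G X C z)"
      using r(1) z(1) by (meson INF_lower less_le_trans)
    then show ?thesis using z(2) by simp
  qed
  then obtain \<pi> where \<pi>: "\<forall>(p, s)\<in>total_dispatch_cost G X C. r < s + \<pi> \<bullet> (d - p)"
    using nonvertical_separation[OF compact_total_dispatch_cost convex_total_dispatch_cost] assms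
    by metis
  \<comment> \<open>The dual value at \<pi> is realized by a point of
    \<open>total_dispatch_cost\<close>, where separation makes it exceed \<open>r\<close>.\<close>
  obtain z where z: "\<And>g. g \<in> G \<Longrightarrow> z g \<in> X g"
    and q: "dual_function G X C d \<pi> = ereal ((\<Sum>g\<in>G. C g (z g)) + \<pi> \<bullet> (d - (\<Sum>g\<in>G. fst (z g))))"
    using dual_function_attained[of G X C d \<pi>, OF assms(2,3) ne] by blast
  have "((\<Sum>g\<in>G. fst (z g)), (\<Sum>g\<in>G. C g (z g))) \<in> total_dispatch_cost G X C"
    using assms(1) z by (intro total_dispatch_costI graph_in_graph_hull)
  with \<pi> q small[of \<pi>] show False by fastforce
qed

theorem theorem1:
  fixes G :: "'g set"
    and X :: "'g \<Rightarrow> 't::{finite,linorder} schedule set"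
    and C :: "'g \<Rightarrow> 't::{finite,linorder} schedule \<Rightarrow> real"
    and d :: "real ^ ('t::{finite,linorder})"
  assumes "finite G"
    and "d \<in> nonneg_orthant"
    and "\<And>g. g \<in> G \<Longrightarrow> unit_feasible_set (X g)"
    and "\<And>g. g \<in> G \<Longrightarrow> offer_cost (X g) (C g)"
    and "\<And>g. g \<in> G \<Longrightarrow> compact (X g)"
  shows "(SUP \<pi>. dual_function G X C d \<pi>) =
           (INF z\<in>chp_feasible G X d. ereal (chp_objective G X C z)) \<and>
         (chp_feasible G X d \<noteq> {} \<longrightarrow>
           (\<exists>z\<in>chp_feasible G X d. ereal (chp_objective G X C z) =
             (INF z'\<in>chp_feasible G X d. ereal (chp_objective G X C z')))) \<and>
         (\<forall>\<pi>. is_arg_max (chp_dual_function G X C d) (\<lambda>_. True) \<pi> \<longrightarrow>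
           is_arg_max (dual_function G X C d) (\<lambda>_. True) \<pi>)"
proof -
  have cont: "continuous_on (X g) (C g)" if "g \<in> G" for g
    using assms(3,4)[OF that] by (intro offer_cost_continuous) (auto simp: unit_feasible_set_def)
  have dual_eq: "chp_dual_function G X C d = dual_function G X C d"
    using assms(5) cont
    by (intro chp_dual_function_eq_dual_function bdd_below_continuous_image_compact)
  have "(SUP \<pi>. dual_function G X C d \<pi>)
      \<le> (INF z\<in>chp_feasible G X d. ereal (chp_objective G X C z))"
    \<comment> \<open>Weak duality is available for the dual over the hulls; equality of the two
      dual functions transfers it, and at the end also gives part (b).\<close>
    unfolding dual_eq[symmetric] by (intro SUP_least INF_greatest chp_weak_duality)
  moreover have "(INF z\<in>chp_feasible G X d. ereal (chp_objective G X C z))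
      \<le> (SUP \<pi>. dual_function G X C d \<pi>)"
    using assms(1,5) cont by (rule chp_strong_duality)
  moreover have "\<exists>z\<in>chp_feasible G X d. ereal (chp_objective G X C z) =
      (INF z'\<in>chp_feasible G X d. ereal (chp_objective G X C z'))"
    if feas: "chp_feasible G X d \<noteq> {}"
  proof -
    obtain z where "z \<in> chp_feasible G X d"
      "\<forall>z'\<in>chp_feasible G X d. chp_objective G X C z \<le> chp_objective G X C z'"
      using chp_primal_attained[of G X C] assms(1,5) cont feas by metis
    then show ?thesis
      by (intro bexI[of _ z] antisym INF_greatest INF_lower) auto
  qed
  ultimately show ?thesis
    using dual_eq by (auto intro: antisym)
qed

end
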